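(* Let $\mathbf{P}=(p_k)_{k\in\mathbb{Z}}$ be a non-trivial probability measure on $\mathbb{Z}$ (where $p_k=\mathbf{P}(\{k\})$). Let $a:=\gcd(w_1-w_2\,;\,w_1,w_2\in\mathrm{Supp}(\mathbf{P}))$; in particular there exists $b\in\mathbb{Z}$ such that $\mathrm{Supp}(\mathbf{P})\subset a\mathbb{Z}+b$. Let $X=(X_k)_{k\geq1}$ be a random walk with increment distribution $\mathbf{P}$ started from some $x_0\in\mathbb{Z}$. Then the following three statements are equivalent: (i) for all $n\in\mathbb{N}$, the law of $X^n:=(X_k)_{k=1}^n$ satisfies the FKG lattice condition; (ii) for all $b'\in\mathbb{Z}$, $\mathbf{P}$ has $(a\mathbb{Z}+b')$-unfavorable crossings; (iii) the function $k\mapsto p_k$ is log-concave on $a\mathbb{Z}+b$.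
   Context: Non-trivial means that $\mathbf{P}$ is not a Dirac mass. $\mathrm{Supp}(\mathbf{P})=\{k\in\mathbb{Z}: p_k>0\}$. FKG lattice condition: a purely atomic probability measure $\mathbf{Q}$ on $\mathbb{R}^n$ satisfies it if $\mathbf{Q}(u\vee v)\,\mathbf{Q}(u\wedge v)\geq \mathbf{Q}(u)\,\mathbf{Q}(v)$ for $\mathbf{Q}$-a.e. $u,v\in\mathbb{R}^n$, where $\mathbf{Q}(u):=\mathbf{Q}(\{u\})$ and $u\vee v$, $u\wedge v$ are the coordinatewise maximum and minimum (lattice operations for the product partial order). Unfavorable crossings: for $\mathcal{X}_1\subset\mathbb{Z}$, the measure $\mathbf{P}$ has $\mathcal{X}_1$-unfavorable crossings if the transition kernel $p_{x,y}:=\mathbf{P}(\{y-x\})$, $x,y\in\mathbb{Z}$, of the random walk with increment distribution $\mathbf{P}$ satisfies, for all $u_1,v_1\in\mathcal{X}_1$ and $u_2,v_2\in\mathbb{Z}$, $$p_{u_1,u_2}\,p_{v_1,v_2}\leq p_{u_1\vee v_1,\,u_2\vee v_2}\;p_{u_1\wedge v_1,\,u_2\wedge v_2}.$$ Log-concavity on $a\mathbb{Z}+b$ means that $k\mapsto\log p_k\in[-\infty,0]$ is concave on $a\mathbb{Z}+b$, i.e. for all $k_1<k_2<k_3$ in $a\mathbb{Z}+b$, $p_{k_2}\geq p_{k_1}^{(k_3-k_2)/(k_3-k_1)}\,p_{k_3}^{(k_2-k_1)/(k_3-k_1)}$. *)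

theory Defs
  imports "HOL-Probability.Probability"
begin

definition int_coset :: "int \<Rightarrow> int \<Rightarrow> int set" where
  "int_coset a b = {a * m + b | m. True}"

text \<open>The product space \<open>\<real>\<^sup>n\<close> with coordinates indexed by \<open>{1..n}\<close>, since \<open>n\<close> varies inside
  statements. Its points are extensional functions, i.e. equal to \<^const>\<open>undefined\<close> outside
  \<open>{1..n}\<close>.\<close>

abbreviation borel_Rn :: "nat \<Rightarrow> (nat \<Rightarrow> real) measure" where
  "borel_Rn n \<equiv> PiM {1..n} (\<lambda>_. borel)"

definition purely_atomic :: "'a measure \<Rightarrow> bool" where
  "purely_atomic Q \<longleftrightarrow>
     (\<exists>A. countable A \<and> (\<forall>x\<in>A. {x} \<in> sets Q) \<and> (AE x in Q. x \<in> A))"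

text \<open>The operations \<^const>\<open>sup\<close> and \<^const>\<open>inf\<close> on \<^typ>\<open>nat \<Rightarrow> real\<close> are the coordinatewise
  maximum and minimum; they preserve extensionality because the extremum of
  \<^const>\<open>undefined\<close> with itself is \<^const>\<open>undefined\<close>. The first three conjuncts say that \<open>Q\<close> is a
  purely atomic probability measure on \<open>\<real>\<^sup>n\<close>, the class of measures for which the condition is
  defined.\<close>

definition FKG_lattice_condition :: "nat \<Rightarrow> (nat \<Rightarrow> real) measure \<Rightarrow> bool" where
  "FKG_lattice_condition n Q \<longleftrightarrow>
     prob_space Q \<and> sets Q = sets (borel_Rn n) \<and> purely_atomic Q \<and>
     (AE u in Q. AE v in Q.
        measure Q {sup u v} * measure Q {inf u v} \<ge> measure Q {u} * measure Q {v})"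

definition transition :: "int pmf \<Rightarrow> int \<Rightarrow> int \<Rightarrow> real" where
  "transition P x y = pmf P (y - x)"

definition unfavorable_crossings :: "int pmf \<Rightarrow> int set \<Rightarrow> bool" where
  "unfavorable_crossings P \<X> \<longleftrightarrow>
     (\<forall>u1\<in>\<X>. \<forall>v1\<in>\<X>. \<forall>u2 v2.
        transition P u1 u2 * transition P v1 v2
          \<le> transition P (max u1 v1) (max u2 v2) * transition P (min u1 v1) (min u2 v2))"

text \<open>Concavity of \<open>k \<mapsto> log (p k)\<close> with values in \<open>[-\<infinity>, 0]\<close>, in multiplicative form. The
  exponents lie strictly between 0 and 1, so \<open>0 powr _ = 0\<close> is the intended value where \<open>p\<close>
  vanishes.\<close>

definition log_concave_on :: "int set \<Rightarrow> (int \<Rightarrow> real) \<Rightarrow> bool" where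
  "log_concave_on S p \<longleftrightarrow>
     (\<forall>k1\<in>S. \<forall>k2\<in>S. \<forall>k3\<in>S. k1 < k2 \<longrightarrow> k2 < k3 \<longrightarrow>
        p k2 \<ge> p k1 powr (real_of_int (k3 - k2) / real_of_int (k3 - k1))
               * p k3 powr (real_of_int (k2 - k1) / real_of_int (k3 - k1)))"

text \<open>The starting point is the position at time 0, so \<open>X 1\<close> is the position after the first
  increment.\<close>

definition random_walk :: "'w measure \<Rightarrow> int pmf \<Rightarrow> int \<Rightarrow> (nat \<Rightarrow> 'w \<Rightarrow> int) \<Rightarrow> bool" where
  "random_walk M P x0 X \<longleftrightarrow>
     prob_space M \<and>
     (\<forall>k. X k \<in> measurable M (count_space UNIV)) \<and>
     (AE \<omega> in M. X 0 \<omega> = x0) \<and>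
     prob_space.indep_vars M (\<lambda>_. count_space UNIV) (\<lambda>k \<omega>. X (Suc k) \<omega> - X k \<omega>) UNIV \<and>
     (\<forall>k. distr M (count_space UNIV) (\<lambda>\<omega>. X (Suc k) \<omega> - X k \<omega>) = measure_pmf P)"

definition law_upto :: "'w measure \<Rightarrow> (nat \<Rightarrow> 'w \<Rightarrow> int) \<Rightarrow> nat \<Rightarrow> (nat \<Rightarrow> real) measure" where
  "law_upto M X n = distr M (borel_Rn n) (\<lambda>\<omega>. \<lambda>k\<in>{1..n}. real_of_int (X k \<omega>))"

end

theory Submission
  imports Defs "HOL-Computational_Algebra.Group_Closure"
begin

text \<open>
  All three properties are equivalent to one inequality,
  \<open>p x * p (x + s + t) \<le> p (x + s) * p (x + t)\<close> for all \<open>x\<close> and all \<open>s, t > 0\<close> such that \<open>a\<close> divides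
  \<open>s\<close>. It compares two ways of making one step from starting points at distance \<open>s\<close> to end points
  at distance \<open>t\<close>: on the left the two steps cross, on the right they do not.

  Unfavourable crossings on all cosets of \<open>a\<int>\<close> are this inequality up to a change of
  variables (\<open>unfavorable_crossings_iff_crossing_bound\<close>), because steps that do not cross give an
  equality. On a coset that contains the support, log-concavity bounds \<open>p (x + s)\<close> and \<open>p (x + t)\<close>
  from below by weighted geometric means of \<open>p x\<close> and \<open>p (x + s + t)\<close> with complementary weights, and
  the product of the two bounds is the inequality. Conversely, the inequality with
  \<open>s = a\<close> says that the increments of \<open>log p\<close> along the coset decrease, so that \<open>log p\<close> lies above
  its chords.

  The law of the walk charges only integer paths, and its atom at a path is the product of the
  probabilities of the increments. The FKG lattice condition is therefore an inequality between
  such products for pairs of paths with a common starting point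
  (\<open>FKG_lattice_condition_iff_path_FKG\<close>). Two charged paths are congruent modulo \<open>a\<close> at all times,
  so it follows from the unfavourable crossings factor by factor.

  For the converse, suppose that two charged paths with \<open>u \<le> v\<close> at all times up to \<open>n\<close> end at
  distance \<open>s\<close>, and let them cross in the next step. Maximum and minimum only exchange that last
  step, so after cancelling the common factor the FKG inequality is the elementary inequality for this \<open>s\<close>.
  It remains to realise every positive multiple \<open>s\<close> of \<open>a\<close> as such a distance
  (\<open>multiple_mem_ordered_gaps\<close>). As \<open>a\<close> is the gcd of the differences of support points, \<open>s\<close> is a
  sum of such differences, but its partial sums may be negative, which would violate
  \<open>u \<le> v\<close>. This is avoided by first letting the distance grow by many copies of one
  positive difference, then adding \<open>s\<close> far away from zero, and finally removing these copies.
\<close>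

section \<open>Elementary crossings and log-concavity\<close>

text \<open>Steps of sizes \<open>x + s + t\<close> from a point \<open>y\<close> and \<open>x\<close> from the point \<open>y + s\<close> cross; exchanging their
end points gives the sizes \<open>x + s\<close> and \<open>x + t\<close>. Only the distance \<open>s\<close> of the starting points has to be
a multiple of \<open>a\<close>.\<close>

definition crossing_bound :: "int \<Rightarrow> (int \<Rightarrow> real) \<Rightarrow> bool" where
  "crossing_bound a p \<longleftrightarrow>
     (\<forall>x s t. a dvd s \<longrightarrow> 0 < s \<longrightarrow> 0 < t \<longrightarrow> p x * p (x + s + t) \<le> p (x + s) * p (x + t))"

lemma crossing_boundD:
  assumes "crossing_bound a p" "a dvd s" "0 < s" "0 < t"
  shows "p x * p (x + s + t) \<le> p (x + s) * p (x + t)"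
  using assms unfolding crossing_bound_def by blast

lemma mem_int_coset_iff: "x \<in> int_coset a b \<longleftrightarrow> a dvd (x - b)"
proof
  assume "x \<in> int_coset a b"
  then show "a dvd (x - b)" by (auto simp: int_coset_def)
next
  assume "a dvd (x - b)"
  then obtain m where "x - b = a * m" by (auto simp: dvd_def)
  then have "x = a * m + b" by simp
  then show "x \<in> int_coset a b" by (auto simp: int_coset_def)
qed

lemma int_coset_diff_dvd:
  assumes "x \<in> int_coset a b" "y \<in> int_coset a b"
  shows "a dvd (x - y)"
  using assms dvd_diff[of a "x - b" "y - b"] by (simp add: mem_int_coset_iff)

text \<open>If the two steps keep their order, or share a starting point, both sides consist of the same
two factors. Otherwise they cross, and the bound applies with \<open>s\<close> and \<open>t\<close> the distances of the
starting and of the end points.\<close>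

lemma crossing_bound_transition:
  assumes C: "crossing_bound a (pmf P)" and dvd: "a dvd (v1 - u1)"
  shows "transition P u1 u2 * transition P v1 v2
          \<le> transition P (max u1 v1) (max u2 v2) * transition P (min u1 v1) (min u2 v2)"
proof -
  \<comment> \<open>By symmetry the steps can be named so that \<open>d\<close> is the higher starting point.\<close>
  have key: "transition P c c' * transition P d d'
      \<le> transition P d (max c' d') * transition P c (min c' d')"
    if "c < d" "a dvd (d - c)" for c d c' d'
  proof (cases "c' \<le> d'")
    case True
    then show ?thesis by (simp add: max_def min_def mult.commute)
  next
    case False
    then have "pmf P (d' - d) * pmf P ((d' - d) + (d - c) + (c' - d'))
        \<le> pmf P ((d' - d) + (d - c)) * pmf P ((d' - d) + (c' - d'))"
      using that by (intro crossing_boundD[OF C]) auto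
    with False show ?thesis
      by (simp add: transition_def max_def min_def algebra_simps)
  qed
  consider "u1 < v1" | "v1 < u1" | "u1 = v1" by linarith
  then show ?thesis
  proof cases
    case 1
    then show ?thesis using key[OF 1 dvd] by (simp add: max_def min_def)
  next
    case 2
    moreover have "a dvd (u1 - v1)" using dvd by (simp add: dvd_diff_commute)
    ultimately show ?thesis
      using key[of v1 u1 v2 u2]
      by (simp add: max.absorb1 min.absorb2 max.commute min.commute mult.commute)
  next
    case 3
    then show ?thesis by (cases "u2 \<le> v2") (simp_all add: max_def min_def mult.commute)
  qed
qed

lemma unfavorable_crossings_iff_crossing_bound:
  "(\<forall>b. unfavorable_crossings P (int_coset a b)) \<longleftrightarrow> crossing_bound a (pmf P)"
proof
  assume L: "\<forall>b. unfavorable_crossings P (int_coset a b)"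
  show "crossing_bound a (pmf P)"
    unfolding crossing_bound_def
  proof (intro allI impI)
    fix x s t :: int
    assume s: "a dvd s" "0 < s" and t: "0 < t"
    have "0 \<in> int_coset a 0" "s \<in> int_coset a 0"
      using s by (simp_all add: mem_int_coset_iff)
    then have "transition P 0 (x + s + t) * transition P s (x + s)
       \<le> transition P (max 0 s) (max (x + s + t) (x + s))
          * transition P (min 0 s) (min (x + s + t) (x + s))"
      using L unfolding unfavorable_crossings_def by blast
    then show "pmf P x * pmf P (x + s + t) \<le> pmf P (x + s) * pmf P (x + t)"
      using s t by (simp add: transition_def max_def min_def mult.commute add_ac)
  qed
next
  assume C: "crossing_bound a (pmf P)"
  show "\<forall>b. unfavorable_crossings P (int_coset a b)"
    unfolding unfavorable_crossings_def
    by (intro allI ballI crossing_bound_transition[OF C] int_coset_diff_dvd)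
qed

text \<open>Each of the increments over \<open>[i, m]\<close> is at most each of those over \<open>[0, i]\<close>. Summing over all
pairs compares \<open>f m - f i\<close> with \<open>f i - f 0\<close>, with weights equal to the lengths of the intervals, and
telescopes to the chord inequality.\<close>

lemma decreasing_increments_chord:
  fixes f :: "nat \<Rightarrow> real"
  assumes "\<And>k l. k < l \<Longrightarrow> l < m \<Longrightarrow> f (Suc l) - f l \<le> f (Suc k) - f k" and im: "i \<le> m"
  shows "real (m - i) * f 0 + real i * f m \<le> real m * f i"
proof -
  have "(\<Sum>k<i. \<Sum>l=i..<m. f (Suc l) - f l) \<le> (\<Sum>k<i. \<Sum>l=i..<m. f (Suc k) - f k)"
    using assms(1) by (intro sum_mono) auto
  moreover have "(\<Sum>l=i..<m. f (Suc l) - f l) = f m - f i"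
    using im by (rule sum_Suc_diff')
  moreover have "(\<Sum>k<i. f (Suc k) - f k) = f i - f 0"
    by (rule sum_lessThan_telescope)
  ultimately have "real i * (f m - f i) \<le> real (m - i) * (f i - f 0)"
    by (simp add: sum_distrib_left[symmetric])
  then show ?thesis
    using im by (simp add: of_nat_diff algebra_simps)
qed

text \<open>The chord inequality is applied to \<open>log p\<close> along the coset. This needs \<open>p > 0\<close> between two points
where \<open>p\<close> is positive, which the crossing bound with these two points as extremes provides.\<close>

lemma crossing_bound_imp_log_concave_on:
  assumes C: "crossing_bound a p" and a: "0 \<le> a" and p_nonneg: "\<And>k. 0 \<le> p k"
  shows "log_concave_on (int_coset a b) p"
  unfolding log_concave_on_def
proof (intro ballI impI)
  fix k1 k2 k3
  assume k: "k1 \<in> int_coset a b" "k2 \<in> int_coset a b" "k3 \<in> int_coset a b" "k1 < k2" "k2 < k3"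
  show "p k1 powr (real_of_int (k3 - k2) / real_of_int (k3 - k1))
          * p k3 powr (real_of_int (k2 - k1) / real_of_int (k3 - k1)) \<le> p k2"
  proof (cases "p k1 = 0 \<or> p k3 = 0")
    case True
    then show ?thesis using p_nonneg by auto
  next
    case False
    then have pos1: "0 < p k1" and pos3: "0 < p k3"
      using p_nonneg[of k1] p_nonneg[of k3] by auto
    obtain i' where i': "k2 - k1 = a * i'"
      using int_coset_diff_dvd[OF k(2) k(1)] by (auto simp: dvd_def)
    obtain m' where m': "k3 - k1 = a * m'"
      using int_coset_diff_dvd[OF k(3) k(1)] by (auto simp: dvd_def)
    have a0: "0 < a" using a i' k by (cases "a = 0") auto
    have "0 < a * i'" "a * i' < a * m'" using i' m' k by auto
    then have im': "0 < i'" "i' < m'" using a0 by (auto simp: zero_less_mult_iff)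
    define i m where "i = nat i'" and "m = nat m'"
    have im: "0 < i" "i < m" using im' by (auto simp: i_def m_def)
    have k2: "k2 = k1 + a * int i" and k3: "k3 = k1 + a * int m"
      using i' m' im' by (auto simp: i_def m_def)
    define q where "q j = p (k1 + a * int j)" for j
    \<comment> \<open>The support has no holes in the coset: split the distance from \<open>k1\<close> to \<open>k3\<close> at \<open>j\<close>.\<close>
    have q_pos: "0 < q j" if "j \<le> m" for j
    proof -
      consider "j = 0" | "j = m" | "0 < j" "j < m" using \<open>j \<le> m\<close> by linarith
      then show ?thesis
      proof cases
        case 3
        have "p k1 * p (k1 + a * int j + a * int (m - j))
              \<le> p (k1 + a * int j) * p (k1 + a * int (m - j))"
          using 3 a0 by (intro crossing_boundD[OF C]) auto
        moreover have "k1 + a * int j + a * int (m - j) = k3"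
          using 3 by (simp add: k3 of_nat_diff algebra_simps)
        ultimately have "0 < p (k1 + a * int j) * p (k1 + a * int (m - j))"
          using mult_pos_pos[OF pos1 pos3] by simp
        then show ?thesis
          using p_nonneg by (metis q_def less_eq_real_def mult_zero_left)
      qed (use pos1 pos3 in \<open>simp_all add: q_def k3\<close>)
    qed
    \<comment> \<open>The crossing bound with \<open>s = a\<close> and \<open>t = a * (l - k)\<close>, in logarithms.\<close>
    have "ln (q (Suc l)) - ln (q l) \<le> ln (q (Suc k)) - ln (q k)" if "k < l" "l < m" for k l
    proof -
      have "p (k1 + a * int k) * p ((k1 + a * int k) + a + a * int (l - k))
            \<le> p ((k1 + a * int k) + a) * p ((k1 + a * int k) + a * int (l - k))"
        using that a0 by (intro crossing_boundD[OF C]) auto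
      moreover have "(k1 + a * int k) + a + a * int (l - k) = k1 + a * int (Suc l)"
        "(k1 + a * int k) + a * int (l - k) = k1 + a * int l"
        "(k1 + a * int k) + a = k1 + a * int (Suc k)"
        using that by (simp_all add: of_nat_diff algebra_simps)
      ultimately have "q k * q (Suc l) \<le> q (Suc k) * q l"
        by (simp only: q_def)
      moreover have "0 < q k" "0 < q l" "0 < q (Suc k)" "0 < q (Suc l)"
        using that by (auto intro!: q_pos)
      ultimately have "ln (q k) + ln (q (Suc l)) \<le> ln (q (Suc k)) + ln (q l)"
        by (simp flip: ln_mult_pos)
      then show ?thesis by simp
    qed
    then have chord: "real (m - i) * ln (q 0) + real i * ln (q m) \<le> real m * ln (q i)"
      using im by (intro decreasing_increments_chord) auto
    have ratio: "real_of_int (k3 - k2) / real_of_int (k3 - k1) = real (m - i) / real m"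
      "real_of_int (k2 - k1) / real_of_int (k3 - k1) = real i / real m"
    proof -
      have "k3 - k2 = a * int (m - i)" "k3 - k1 = a * int m" "k2 - k1 = a * int i"
        using im by (simp_all add: k2 k3 of_nat_diff algebra_simps)
      then show "real_of_int (k3 - k2) / real_of_int (k3 - k1) = real (m - i) / real m"
        "real_of_int (k2 - k1) / real_of_int (k3 - k1) = real i / real m"
        using a0 by simp_all
    qed
    have "real (m - i) / real m * ln (q 0) + real i / real m * ln (q m)
        = (real (m - i) * ln (q 0) + real i * ln (q m)) / real m"
      by (simp add: add_divide_distrib)
    also have "\<dots> \<le> ln (q i)"
      using chord im by (simp add: divide_le_eq mult.commute)
    finally have "exp (real (m - i) / real m * ln (q 0) + real i / real m * ln (q m))
        \<le> exp (ln (q i))"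
      by simp
    moreover have "p k1 = q 0" "p k2 = q i" "p k3 = q m"
      by (simp_all add: q_def k2 k3)
    moreover have "0 < q 0" "0 < q i" "0 < q m" using im by (auto intro!: q_pos)
    ultimately show ?thesis
      by (simp only: ratio) (simp add: powr_def exp_add)
  qed
qed

text \<open>The points \<open>x + s\<close> and \<open>x + t\<close> are reflections of each other in \<open>[x, x + s + t]\<close>, so the weights in
their log-concavity bounds are exchanged and each end point receives total weight one. If both end
points are charged, they lie in the coset; then so do the inner points, as \<open>a\<close> divides \<open>s\<close>.\<close>

lemma log_concave_on_imp_crossing_bound:
  assumes L: "log_concave_on (int_coset a b) p" and p_nonneg: "\<And>k. 0 \<le> p k"
    and supp: "\<And>k. p k \<noteq> 0 \<Longrightarrow> k \<in> int_coset a b"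
  shows "crossing_bound a p"
  unfolding crossing_bound_def
proof (intro allI impI)
  fix x s t :: int
  assume s: "a dvd s" "0 < s" and t: "0 < t"
  show "p x * p (x + s + t) \<le> p (x + s) * p (x + t)"
  proof (cases "p x = 0 \<or> p (x + s + t) = 0")
    case True
    then show ?thesis using p_nonneg by auto
  next
    case False
    then have nz: "p x \<noteq> 0" "p (x + s + t) \<noteq> 0" by auto
    then have pos: "0 < p x" "0 < p (x + s + t)"
      using p_nonneg[of x] p_nonneg[of "x + s + t"] by linarith+
    have ends: "x \<in> int_coset a b" "x + s + t \<in> int_coset a b"
      using nz supp by auto
    have "x + s - b = (x - b) + s" "x + t - b = (x + s + t - b) - s" by simp_all
    then have mid: "x + s \<in> int_coset a b" "x + t \<in> int_coset a b"
      using ends s unfolding mem_int_coset_iff by (metis dvd_add, metis dvd_diff)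
    define \<alpha> \<beta> where "\<alpha> = real_of_int t / real_of_int (s + t)"
      and "\<beta> = real_of_int s / real_of_int (s + t)"
    have sum1: "\<alpha> + \<beta> = 1"
      using s t by (simp add: \<alpha>_def \<beta>_def flip: add_divide_distrib)
    have 1: "p x powr \<alpha> * p (x + s + t) powr \<beta> \<le> p (x + s)"
      using L[unfolded log_concave_on_def, rule_format, OF ends(1) mid(1) ends(2)] s t
      by (simp add: \<alpha>_def \<beta>_def)
    have 2: "p x powr \<beta> * p (x + s + t) powr \<alpha> \<le> p (x + t)"
      using L[unfolded log_concave_on_def, rule_format, OF ends(1) mid(2) ends(2)] s t
      by (simp add: \<alpha>_def \<beta>_def)
    have "p x * p (x + s + t) = p x powr (\<alpha> + \<beta>) * p (x + s + t) powr (\<alpha> + \<beta>)"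
      using pos by (simp add: sum1)
    also have "\<dots> = (p x powr \<alpha> * p (x + s + t) powr \<beta>) * (p x powr \<beta> * p (x + s + t) powr \<alpha>)"
      by (simp add: powr_add mult_ac)
    also have "\<dots> \<le> p (x + s) * p (x + t)"
      using 1 2 p_nonneg by (intro mult_mono) auto
    finally show ?thesis .
  qed
qed

section \<open>Paths and the law of the walk\<close>

definition path_weight :: "int pmf \<Rightarrow> nat \<Rightarrow> (nat \<Rightarrow> int) \<Rightarrow> real" where
  "path_weight P n u = (\<Prod>k<n. pmf P (u (Suc k) - u k))"

lemma path_weight_nonneg: "0 \<le> path_weight P n u"
  by (simp add: path_weight_def prod_nonneg)

definition path_FKG :: "int pmf \<Rightarrow> int \<Rightarrow> nat \<Rightarrow> bool" where
  "path_FKG P x0 n \<longleftrightarrow>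
     (\<forall>u v. u 0 = x0 \<longrightarrow> v 0 = x0 \<longrightarrow>
        path_weight P n u * path_weight P n v
          \<le> path_weight P n (\<lambda>k. max (u k) (v k)) * path_weight P n (\<lambda>k. min (u k) (v k)))"

text \<open>An integer path as a point of \<open>borel_Rn n\<close>. The value of \<open>u\<close> at 0, the deterministic starting point,
is not a coordinate.\<close>

definition real_path :: "nat \<Rightarrow> (nat \<Rightarrow> int) \<Rightarrow> nat \<Rightarrow> real" where
  "real_path n u = (\<lambda>k\<in>{1..n}. real_of_int (u k))"

lemma real_path_eq_iff: "real_path n u = real_path n v \<longleftrightarrow> (\<forall>k\<in>{1..n}. u k = v k)"
proof
  assume eq: "real_path n u = real_path n v"
  show "\<forall>k\<in>{1..n}. u k = v k"
  proof
    fix k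
    assume "k \<in> {1..n}"
    then show "u k = v k" using fun_cong[OF eq, of k] by (simp add: real_path_def)
  qed
qed (auto simp: real_path_def)

lemma sup_real_path: "sup (real_path n u) (real_path n v) = real_path n (\<lambda>k. max (u k) (v k))"
  by (auto simp: real_path_def sup_fun_def sup_max of_int_max)

lemma inf_real_path: "inf (real_path n u) (real_path n v) = real_path n (\<lambda>k. min (u k) (v k))"
  by (auto simp: real_path_def inf_fun_def inf_min of_int_min)

lemma countable_range_real_path: "countable (range (real_path n))"
proof -
  have "range (real_path n) \<subseteq> {1..n} \<rightarrow>\<^sub>E range real_of_int"
    by (auto simp: real_path_def)
  moreover have "countable ({1..n} \<rightarrow>\<^sub>E range real_of_int)"
    by (intro countable_PiE) auto
  ultimately show ?thesis by (rule countable_subset)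
qed

lemma singleton_real_path_borel: "{real_path n u} \<in> sets (borel_Rn n)"
proof -
  have "(\<Pi>\<^sub>E k\<in>{1..n}. {real_path n u k}) = {real_path n u}"
    unfolding real_path_def by (rule PiE_singleton) (rule restrict_extensional)
  moreover have "(\<Pi>\<^sub>E k\<in>{1..n}. {real_path n u k}) \<in> sets (borel_Rn n)"
    by (rule sets_PiM_I_finite) auto
  ultimately show ?thesis by simp
qed

text \<open>A null set cannot contain an atom, so almost sure statements hold pointwise at atoms.\<close>

lemma AE_imp_at_atom:
  assumes "AE x in Q. R x" "0 < measure Q {u}"
  shows "R u"
proof (rule ccontr)
  assume "\<not> R u"
  from assms(1) obtain N where N: "{x \<in> space Q. \<not> R x} \<subseteq> N" "emeasure Q N = 0" "N \<in> sets Q"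
    by (rule AE_E)
  have "{u} \<in> sets Q"
    using assms(2) measure_notin_sets by fastforce
  then have "u \<in> N" using N \<open>\<not> R u\<close> sets.sets_into_space by blast
  then have "emeasure Q {u} \<le> emeasure Q N" using N by (intro emeasure_mono) auto
  then show False using N assms(2) by (simp add: measure_def)
qed

lemma measurable_walk_path:
  assumes "\<And>k. X k \<in> measurable M (count_space UNIV)"
  shows "(\<lambda>\<omega>. real_path n (\<lambda>k. X k \<omega>)) \<in> measurable M (borel_Rn n)"
  unfolding real_path_def
proof (rule measurable_restrict)
  fix k
  show "(\<lambda>\<omega>. real_of_int (X k \<omega>)) \<in> borel_measurable M"
    by (rule measurable_compose[OF assms]) simp
qed

lemma law_upto_eq_distr_real_path:
  "law_upto M X n = distr M (borel_Rn n) (\<lambda>\<omega>. real_path n (\<lambda>k. X k \<omega>))"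
  by (simp add: law_upto_def real_path_def)

text \<open>Given the starting point, following \<open>u\<close> up to time \<open>n\<close> means having the increments of \<open>u\<close>, and these
are independent with law \<open>P\<close>.\<close>

lemma law_upto_singleton:
  assumes walk: "random_walk M P x0 X" and n: "1 \<le> n" and u0: "u 0 = x0"
  shows "measure (law_upto M X n) {real_path n u} = path_weight P n u"
proof -
  interpret prob_space M using walk by (simp add: random_walk_def)
  have X[measurable]: "\<And>k. X k \<in> measurable M (count_space UNIV)"
    using walk by (simp add: random_walk_def)
  have start: "AE \<omega> in M. X 0 \<omega> = x0"
    using walk by (simp add: random_walk_def)
  define D where "D k \<omega> = X (Suc k) \<omega> - X k \<omega>" for k \<omega>
  have D[measurable]: "\<And>k. D k \<in> measurable M (count_space UNIV)"
    unfolding D_def by measurable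
  have indep: "indep_vars (\<lambda>_. count_space UNIV) D UNIV"
    using walk by (simp add: random_walk_def D_def[abs_def])
  have dist: "distr M (count_space UNIV) (D k) = measure_pmf P" for k
    using walk by (simp add: random_walk_def D_def[abs_def])
  have step_prob: "prob (D k -` {z} \<inter> space M) = pmf P z" for k z
    using measure_distr[OF D[of k], of "{z}"] by (simp add: dist pmf.rep_eq)
  have same_path: "(\<forall>k\<in>{1..n}. X k \<omega> = u k) \<longleftrightarrow> (\<forall>k<n. D k \<omega> = u (Suc k) - u k)"
    if "X 0 \<omega> = x0" for \<omega>
  proof
    assume A: "\<forall>k\<in>{1..n}. X k \<omega> = u k"
    then have "X k \<omega> = u k" if "k \<le> n" for k
      using that \<open>X 0 \<omega> = x0\<close> u0 by (cases k) auto
    then show "\<forall>k<n. D k \<omega> = u (Suc k) - u k" by (auto simp: D_def)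
  next
    assume A: "\<forall>k<n. D k \<omega> = u (Suc k) - u k"
    have "X k \<omega> = u k" if "k \<le> n" for k
      using that
    proof (induction k)
      case 0
      then show ?case using \<open>X 0 \<omega> = x0\<close> u0 by simp
    next
      case (Suc k)
      then show ?case using A[rule_format, of k] by (simp add: D_def)
    qed
    then show "\<forall>k\<in>{1..n}. X k \<omega> = u k" by auto
  qed
  have "measure (law_upto M X n) {real_path n u}
      = prob ((\<lambda>\<omega>. real_path n (\<lambda>k. X k \<omega>)) -` {real_path n u} \<inter> space M)"
    unfolding law_upto_eq_distr_real_path
    by (intro measure_distr measurable_walk_path X singleton_real_path_borel)
  also have "(\<lambda>\<omega>. real_path n (\<lambda>k. X k \<omega>)) -` {real_path n u} \<inter> space M
      = {\<omega> \<in> space M. \<forall>k\<in>{1..n}. X k \<omega> = u k}"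
    by (auto simp: real_path_eq_iff)
  also have "prob \<dots> = prob {\<omega> \<in> space M. \<forall>k<n. D k \<omega> = u (Suc k) - u k}"
    using start same_path by (intro finite_measure_eq_AE) auto
  also have "{\<omega> \<in> space M. \<forall>k<n. D k \<omega> = u (Suc k) - u k}
      = (\<Inter>k\<in>{..<n}. D k -` {u (Suc k) - u k} \<inter> space M)"
    using n by (auto simp: lessThan_empty_iff)
  also have "prob \<dots> = (\<Prod>k<n. prob (D k -` {u (Suc k) - u k} \<inter> space M))"
    using n by (intro indep_varsD[OF indep]) (auto simp: lessThan_empty_iff)
  finally show ?thesis by (simp add: step_prob path_weight_def)
qed

text \<open>The law is carried by the countable set of integer paths. Paths of weight zero satisfy the
inequality trivially, and the others are atoms, at which the almost sure inequality holds.\<close>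

lemma FKG_lattice_condition_iff_path_FKG:
  assumes walk: "random_walk M P x0 X" and n: "1 \<le> n"
  shows "FKG_lattice_condition n (law_upto M X n) \<longleftrightarrow> path_FKG P x0 n"
proof -
  interpret prob_space M using walk by (simp add: random_walk_def)
  have X[measurable]: "\<And>k. X k \<in> measurable M (count_space UNIV)"
    using walk by (simp add: random_walk_def)
  have start: "AE \<omega> in M. X 0 \<omega> = x0"
    using walk by (simp add: random_walk_def)
  let ?Q = "law_upto M X n"
  define A where "A = real_path n ` {u. u 0 = x0}"
  note Q = law_upto_eq_distr_real_path[of M X n]
  have sets: "sets ?Q = sets (borel_Rn n)"
    by (simp add: Q)
  have prob: "prob_space ?Q"
    unfolding Q by (rule prob_space_distr[OF measurable_walk_path[OF X]])
  have countable: "countable A"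
    using countable_range_real_path by (rule countable_subset[rotated]) (auto simp: A_def)
  have atoms: "{x} \<in> sets (borel_Rn n)" if "x \<in> A" for x
    using that singleton_real_path_borel by (auto simp: A_def)
  have "A \<in> sets (borel_Rn n)"
    using countable atoms by (rule sets.countable[rotated])
  then have A_meas: "{x \<in> space (borel_Rn n). x \<in> A} \<in> sets (borel_Rn n)"
    using sets.Int_space_eq1[of A "borel_Rn n"] by (simp add: Int_def)
  have onA: "AE x in ?Q. x \<in> A"
    unfolding Q AE_distr_iff[OF measurable_walk_path[OF X] A_meas]
    using start by eventually_elim (auto simp: A_def)
  have pure: "purely_atomic ?Q"
    unfolding purely_atomic_def using countable atoms onA by (auto simp: sets)
  note mass = law_upto_singleton[OF walk n]
  show ?thesis
  proof
    assume "FKG_lattice_condition n ?Q"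
    then have AE: "AE u in ?Q. AE v in ?Q.
        measure ?Q {u} * measure ?Q {v} \<le> measure ?Q {sup u v} * measure ?Q {inf u v}"
      by (simp add: FKG_lattice_condition_def)
    show "path_FKG P x0 n"
      unfolding path_FKG_def
    proof (intro allI impI)
      fix u v :: "nat \<Rightarrow> int"
      assume uv: "u 0 = x0" "v 0 = x0"
      show "path_weight P n u * path_weight P n v
          \<le> path_weight P n (\<lambda>k. max (u k) (v k)) * path_weight P n (\<lambda>k. min (u k) (v k))"
      proof (cases "path_weight P n u = 0 \<or> path_weight P n v = 0")
        case True
        then show ?thesis by (auto simp: path_weight_nonneg)
      next
        case False
        then have pos: "0 < measure ?Q {real_path n u}" "0 < measure ?Q {real_path n v}"
          using path_weight_nonneg[of P n u] path_weight_nonneg[of P n v] uv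
          by (auto simp: mass)
        show ?thesis
          using AE_imp_at_atom[OF AE_imp_at_atom[OF AE pos(1)] pos(2)] uv
          by (simp add: sup_real_path inf_real_path mass)
      qed
    qed
  next
    assume F: "path_FKG P x0 n"
    have pair: "measure ?Q {x} * measure ?Q {y} \<le> measure ?Q {sup x y} * measure ?Q {inf x y}"
      if "x \<in> A" "y \<in> A" for x y
    proof -
      from that obtain u v where uv: "u 0 = x0" "v 0 = x0" "x = real_path n u" "y = real_path n v"
        by (auto simp: A_def)
      then show ?thesis
        using F[unfolded path_FKG_def, rule_format, of u v]
        by (simp add: sup_real_path inf_real_path mass)
    qed
    have "AE u in ?Q. AE v in ?Q.
        measure ?Q {u} * measure ?Q {v} \<le> measure ?Q {sup u v} * measure ?Q {inf u v}"
      using onA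
    proof eventually_elim
      case (elim u)
      show ?case using onA by eventually_elim (rule pair[OF elim])
    qed
    then show "FKG_lattice_condition n ?Q"
      using prob sets pure by (simp add: FKG_lattice_condition_def)
  qed
qed

section \<open>From elementary crossings to paths\<close>

lemma path_weight_pos_iff: "0 < path_weight P n u \<longleftrightarrow> (\<forall>k<n. u (Suc k) - u k \<in> set_pmf P)"
proof -
  have "0 < path_weight P n u \<longleftrightarrow> path_weight P n u \<noteq> 0"
    using path_weight_nonneg[of P n u] by linarith
  then show ?thesis by (auto simp: path_weight_def set_pmf_iff)
qed

text \<open>In each step the difference of the two paths changes by a difference of two points of the
support.\<close>

lemma charged_paths_congruent:
  assumes diff: "\<And>w w'. w \<in> set_pmf P \<Longrightarrow> w' \<in> set_pmf P \<Longrightarrow> a dvd (w - w')"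
    and u: "0 < path_weight P n u" and v: "0 < path_weight P n v" and "u 0 = v 0" and "k \<le> n"
  shows "a dvd (v k - u k)"
  using \<open>k \<le> n\<close>
proof (induction k)
  case 0
  then show ?case using \<open>u 0 = v 0\<close> by simp
next
  case (Suc k)
  have "a dvd ((v (Suc k) - v k) - (u (Suc k) - u k))"
    using u v Suc.prems by (intro diff) (auto simp: path_weight_pos_iff)
  with Suc have "a dvd ((v k - u k) + ((v (Suc k) - v k) - (u (Suc k) - u k)))"
    by (intro dvd_add) auto
  then show ?case by (simp add: algebra_simps)
qed

text \<open>The inequality between path weights is the product over all times of the inequalities for the
single steps, whose starting points are congruent modulo \<open>a\<close>.\<close>

lemma crossing_bound_imp_path_FKG:
  assumes C: "crossing_bound a (pmf P)"
    and diff: "\<And>w w'. w \<in> set_pmf P \<Longrightarrow> w' \<in> set_pmf P \<Longrightarrow> a dvd (w - w')"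
  shows "path_FKG P x0 n"
  unfolding path_FKG_def
proof (intro allI impI)
  fix u v :: "nat \<Rightarrow> int"
  assume uv: "u 0 = x0" "v 0 = x0"
  show "path_weight P n u * path_weight P n v
      \<le> path_weight P n (\<lambda>k. max (u k) (v k)) * path_weight P n (\<lambda>k. min (u k) (v k))"
  proof (cases "path_weight P n u = 0 \<or> path_weight P n v = 0")
    case True
    then show ?thesis by (auto simp: path_weight_nonneg)
  next
    case False
    then have pos: "0 < path_weight P n u" "0 < path_weight P n v"
      using path_weight_nonneg[of P n u] path_weight_nonneg[of P n v] by linarith+
    have "pmf P (u (Suc k) - u k) * pmf P (v (Suc k) - v k)
        \<le> pmf P (max (u (Suc k)) (v (Suc k)) - max (u k) (v k))
           * pmf P (min (u (Suc k)) (v (Suc k)) - min (u k) (v k))" if "k < n" for k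
      using crossing_bound_transition[OF C charged_paths_congruent[OF diff pos, of k]] uv that
      by (simp add: transition_def)
    then show ?thesis
      unfolding path_weight_def prod.distrib[symmetric] by (intro prod_mono) auto
  qed
qed

section \<open>From paths to elementary crossings\<close>

text \<open>The order \<open>u \<le> v\<close> is imposed at all times, not only at \<open>n\<close>, so that \<open>v\<close> and \<open>u\<close> are the maximum and the
minimum of the two paths, and a pair of crossing steps appended at time \<open>n\<close> is the only crossing.\<close>

definition ordered_gaps :: "int pmf \<Rightarrow> int \<Rightarrow> int set" where
  "ordered_gaps P x0 = {v n - u n | n u v. u 0 = x0 \<and> v 0 = x0 \<and> (\<forall>k\<le>n. u k \<le> v k) \<and>
     0 < path_weight P n u \<and> 0 < path_weight P n v}"

lemma path_weight_cong:
  "(\<And>k. k \<le> n \<Longrightarrow> u k = v k) \<Longrightarrow> path_weight P n u = path_weight P n v"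
  by (simp add: path_weight_def)

lemma path_weight_extend:
  "path_weight P (Suc n) (u(Suc n := z)) = path_weight P n u * pmf P (z - u n)"
proof -
  have "path_weight P n (u(Suc n := z)) = path_weight P n u"
    by (rule path_weight_cong) auto
  then show ?thesis by (simp add: path_weight_def)
qed

lemma zero_in_ordered_gaps: "0 \<in> ordered_gaps P x0"
  unfolding ordered_gaps_def
  by (intro CollectI exI[of _ 0] exI[of _ "\<lambda>_. x0"]) (auto simp: path_weight_def)

lemma ordered_gaps_step:
  assumes g: "g \<in> ordered_gaps P x0" and w: "w \<in> set_pmf P" "w' \<in> set_pmf P"
    and nonneg: "0 \<le> g + (w - w')"
  shows "g + (w - w') \<in> ordered_gaps P x0"
proof -
  from g obtain n u v where uv: "g = v n - u n" "u 0 = x0" "v 0 = x0" "\<forall>k\<le>n. u k \<le> v k"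
    "0 < path_weight P n u" "0 < path_weight P n v"
    by (auto simp: ordered_gaps_def)
  let ?u = "u(Suc n := u n + w')" and ?v = "v(Suc n := v n + w)"
  have "0 < path_weight P (Suc n) ?u" "0 < path_weight P (Suc n) ?v"
    using uv w by (simp_all add: path_weight_extend pmf_positive)
  moreover have "\<forall>k\<le>Suc n. ?u k \<le> ?v k"
    using uv nonneg by (auto simp: le_Suc_eq)
  moreover have "g + (w - w') = ?v (Suc n) - ?u (Suc n)"
    using uv by simp
  ultimately show ?thesis
    unfolding ordered_gaps_def using uv(2,3)
    by (intro CollectI exI[of _ "Suc n"] exI[of _ ?u] exI[of _ ?v]) simp
qed

text \<open>Far away from zero the ordering of the paths is no obstacle to appending a pair of steps, so
every large gap can be translated by a difference of support points. Composing two such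
translations only raises the threshold, and the differences of support points are closed under
negation, so the translations reach the whole subgroup that these differences generate.\<close>

lemma ordered_gaps_translate:
  assumes "z \<in> group_closure {w1 - w2 | w1 w2. w1 \<in> set_pmf P \<and> w2 \<in> set_pmf P}"
  shows "\<exists>K. \<forall>g\<in>ordered_gaps P x0. K \<le> g \<longrightarrow> g + z \<in> ordered_gaps P x0"
proof -
  let ?D = "{w1 - w2 | w1 w2. w1 \<in> set_pmf P \<and> w2 \<in> set_pmf P}"
  let ?H = "\<lambda>z. \<exists>K. \<forall>g\<in>ordered_gaps P x0. K \<le> g \<longrightarrow> g + z \<in> ordered_gaps P x0"
  have base: "?H z" if "z \<in> ?D" for z
  proof -
    have "g + z \<in> ordered_gaps P x0" if "g \<in> ordered_gaps P x0" "- z \<le> g" for g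
      using \<open>z \<in> ?D\<close> that ordered_gaps_step[of g P x0] by force
    then show ?thesis by blast
  qed
  have add: "?H (s + t)" if "?H s" "?H t" for s t
  proof -
    from that obtain K L where
      K: "\<And>g. g \<in> ordered_gaps P x0 \<Longrightarrow> K \<le> g \<Longrightarrow> g + s \<in> ordered_gaps P x0" and
      L: "\<And>g. g \<in> ordered_gaps P x0 \<Longrightarrow> L \<le> g \<Longrightarrow> g + t \<in> ordered_gaps P x0"
      by blast
    have "g + (s + t) \<in> ordered_gaps P x0" if "g \<in> ordered_gaps P x0" "max K (L - s) \<le> g" for g
      using L[OF K[of g]] that by (simp add: add.assoc)
    then show ?thesis by blast
  qed
  from assms have "?H z \<and> ?H (- z)"
  proof (induction rule: group_closure.induct)
    case (base z)
    show ?case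
    proof (cases "z = 0")
      case False
      with base have "z \<in> ?D" by simp
      moreover from this have "- z \<in> ?D" by force
      ultimately show ?thesis using \<open>\<And>z. z \<in> ?D \<Longrightarrow> ?H z\<close> by blast
    qed simp
  next
    case (diff s t)
    then show ?case using add[of s "- t"] add[of t "- s"] by simp
  qed
  then show ?thesis ..
qed

text \<open>Starting at 0, climb by multiples of a positive difference \<open>e\<close> to a gap large enough for the
translation by \<open>s\<close>, then descend by the same multiple. The descent ends at \<open>s > 0\<close>, so all
gaps on the way are positive.\<close>

lemma multiple_mem_ordered_gaps:
  assumes a: "a = Gcd {w1 - w2 | w1 w2. w1 \<in> set_pmf P \<and> w2 \<in> set_pmf P}"
    and s: "a dvd s" "0 < s"
  shows "s \<in> ordered_gaps P x0"
proof -
  let ?D = "{w1 - w2 | w1 w2. w1 \<in> set_pmf P \<and> w2 \<in> set_pmf P}"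
  let ?G = "ordered_gaps P x0"
  have "a \<noteq> 0" using s by auto
  then obtain d where "d \<in> ?D" "d \<noteq> 0" using a by (auto simp: Gcd_0_iff)
  then obtain w w' where ww: "w \<in> set_pmf P" "w' \<in> set_pmf P" "w' < w"
    by (auto simp: neq_iff)
  define e where "e = w - w'"
  have e: "0 < e" using ww by (simp add: e_def)
  have up: "int N * e \<in> ?G" for N
  proof (induction N)
    case 0
    show ?case by (simp add: zero_in_ordered_gaps)
  next
    case (Suc N)
    have "0 \<le> int N * e + (w - w')" using e by (simp add: e_def)
    from ordered_gaps_step[OF Suc ww(1,2) this] show ?case
      by (simp add: e_def algebra_simps)
  qed
  have down: "g \<in> ?G" if "g + int N * e \<in> ?G" "0 \<le> g" for g N
    using that
  proof (induction N)
    case (Suc N)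
    have "0 \<le> g + int N * e" using Suc.prems e by simp
    then have "g + int N * e \<in> ?G"
      using ordered_gaps_step[OF Suc.prems(1) ww(2,1)] by (simp add: e_def algebra_simps)
    then show ?case using Suc by blast
  qed simp
  have "s \<in> group_closure ?D"
    using s a by (auto simp: group_closure_eq dvd_def)
  then obtain K where K: "\<And>g. g \<in> ?G \<Longrightarrow> K \<le> g \<Longrightarrow> g + s \<in> ?G"
    using ordered_gaps_translate[of s P x0] by blast
  define N where "N = nat K"
  have "K \<le> int N" by (simp add: N_def)
  also have "\<dots> \<le> int N * e" using e mult_left_mono[of 1 e "int N"] by simp
  finally have "int N * e + s \<in> ?G" using K up by blast
  then show ?thesis using down[of s N] s by (simp add: add.commute)
qed

text \<open>Two ordered paths that end at distance \<open>s\<close> are extended by crossing steps of sizes \<open>x + s + t\<close> and \<open>x\<close>.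
Maximum and minimum of the extended paths are the two old paths with the end points of the last
steps exchanged, so the weights of the old paths cancel.\<close>

lemma path_FKG_imp_crossing_bound:
  assumes a: "a = Gcd {w1 - w2 | w1 w2. w1 \<in> set_pmf P \<and> w2 \<in> set_pmf P}"
    and F: "\<And>n. 1 \<le> n \<Longrightarrow> path_FKG P x0 n"
  shows "crossing_bound a (pmf P)"
  unfolding crossing_bound_def
proof (intro allI impI)
  fix x s t :: int
  assume s: "a dvd s" "0 < s" and t: "0 < t"
  obtain n u v where uv: "s = v n - u n" "u 0 = x0" "v 0 = x0" "\<forall>k\<le>n. u k \<le> v k"
    "0 < path_weight P n u" "0 < path_weight P n v"
    using multiple_mem_ordered_gaps[OF a s, of x0] by (auto simp: ordered_gaps_def)
  define y z where "y = u n + x + s + t" and "z = v n + x"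
  have zy: "z \<le> y" using uv(1) t by (simp add: y_def z_def)
  let ?u = "u(Suc n := y)" and ?v = "v(Suc n := z)"
  have "path_weight P (Suc n) (\<lambda>k. max (?u k) (?v k)) = path_weight P (Suc n) (v(Suc n := y))"
    "path_weight P (Suc n) (\<lambda>k. min (?u k) (?v k)) = path_weight P (Suc n) (u(Suc n := z))"
    using uv(4) zy by (auto intro!: path_weight_cong simp: le_Suc_eq max_def min_def)
  then have "path_weight P (Suc n) ?u * path_weight P (Suc n) ?v
      \<le> path_weight P (Suc n) (v(Suc n := y)) * path_weight P (Suc n) (u(Suc n := z))"
    using F[of "Suc n", unfolded path_FKG_def, rule_format, of ?u ?v] uv(2,3) by simp
  then have "path_weight P n u * path_weight P n v * (pmf P x * pmf P (x + s + t))
      \<le> path_weight P n u * path_weight P n v * (pmf P (x + s) * pmf P (x + t))"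
  proof -
    have "y - u n = x + s + t" "z - v n = x" "y - v n = x + t" "z - u n = x + s"
      using uv(1) by (simp_all add: y_def z_def)
    with \<open>path_weight P (Suc n) ?u * _ \<le> _\<close> show ?thesis
      by (simp add: path_weight_extend mult_ac)
  qed
  then show "pmf P x * pmf P (x + s + t) \<le> pmf P (x + s) * pmf P (x + t)"
    using mult_pos_pos[OF uv(5,6)] by (rule mult_left_le_imp_le)
qed

section \<open>The equivalence\<close>

theorem proposition1p12:
  fixes P :: "int pmf" and a x0 :: int
    and M :: "'w measure" and X :: "nat \<Rightarrow> 'w \<Rightarrow> int"
  assumes nontrivial: "\<nexists>k. P = return_pmf k"
    and a_def: "a = Gcd {w1 - w2 | w1 w2. w1 \<in> set_pmf P \<and> w2 \<in> set_pmf P}"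
    and walk: "random_walk M P x0 X"
  shows "(\<exists>b. set_pmf P \<subseteq> int_coset a b) \<and>
    (\<forall>b. set_pmf P \<subseteq> int_coset a b \<longrightarrow>
      ((\<forall>n\<ge>1. FKG_lattice_condition n (law_upto M X n)) \<longleftrightarrow>
        (\<forall>b'. unfavorable_crossings P (int_coset a b'))) \<and>
      ((\<forall>b'. unfavorable_crossings P (int_coset a b')) \<longleftrightarrow>
        log_concave_on (int_coset a b) (pmf P)))"
proof -
  have diff: "a dvd (w - w')" if "w \<in> set_pmf P" "w' \<in> set_pmf P" for w w'
    unfolding a_def using that by (intro Gcd_dvd) auto
  obtain w where "w \<in> set_pmf P" using set_pmf_not_empty[of P] by blast
  then have coset: "set_pmf P \<subseteq> int_coset a w"
    using diff by (auto simp: mem_int_coset_iff)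
  have "(\<forall>n\<ge>1. FKG_lattice_condition n (law_upto M X n)) \<longleftrightarrow> (\<forall>n\<ge>1. path_FKG P x0 n)"
    using FKG_lattice_condition_iff_path_FKG[OF walk] by blast
  also have "\<dots> \<longleftrightarrow> crossing_bound a (pmf P)"
    using path_FKG_imp_crossing_bound[OF a_def] crossing_bound_imp_path_FKG[OF _ diff] by blast
  finally have FKG: "(\<forall>n\<ge>1. FKG_lattice_condition n (law_upto M X n)) \<longleftrightarrow>
      crossing_bound a (pmf P)" .
  have "0 \<le> a" by (simp add: a_def)
  have concave: "crossing_bound a (pmf P) \<longleftrightarrow> log_concave_on (int_coset a b) (pmf P)"
    if "set_pmf P \<subseteq> int_coset a b" for b
  proof -
    have "k \<in> int_coset a b" if "pmf P k \<noteq> 0" for k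
      using that \<open>set_pmf P \<subseteq> int_coset a b\<close> by (auto simp: set_pmf_iff)
    then show ?thesis
      using \<open>0 \<le> a\<close> crossing_bound_imp_log_concave_on[of a "pmf P" b]
        log_concave_on_imp_crossing_bound[of a b "pmf P"]
      by auto
  qed
  show ?thesis
    unfolding unfavorable_crossings_iff_crossing_bound
    using coset FKG concave by blast
qed

end
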